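(* Let $\Omega\subset\mathbb{R}^n$ be a smooth open domain, let $\rho$ be a positive continuously differentiable function of $t\ge 0$, and let $A(\omega)=\rho(|\omega|^2)\,\omega$ for $k$-forms $\omega$. Assume that the function $$\phi_\rho(t):=t\,\rho^2(t),$$ when restricted to the connected interval $(t_1,t_2)$, satisfies either $\dfrac{d\phi_\rho}{dt}>0$ on $(t_1,t_2)$ or $\dfrac{d\phi_\rho}{dt}<0$ on $(t_1,t_2)$. Let $(r_1,r_2)$ be the image of $(t_1,t_2)$ under $\phi_\rho$. Then $A$ restricted to $\Lambda^k(\Omega)_{t_1,t_2}$ is a map $$A:\Lambda^k(\Omega)_{t_1,t_2}\to\Lambda^k(\Omega)_{r_1,r_2},$$ and this restriction is invertible with inverse $$B:\Lambda^k(\Omega)_{r_1,r_2}\to\Lambda^k(\Omega)_{t_1,t_2},\qquad B(\tilde\omega)=\frac{\tilde\omega}{\rho\big(\psi(|\tilde\omega|^2)\big)},$$ where $\psi:=\big(\phi_\rho|_{(t_1,t_2)}\big)^{-1}:(r_1,r_2)\to(t_1,t_2)$.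
   Context: $\Lambda^k(\Omega)$ denotes the differential $k$-forms on $\Omega$ with the Euclidean metric, and $|\omega|^2=*(\omega\wedge *\omega)$, where $*$ is the Hodge star. For an interval $(a,b)$, $0\le a<b\le\infty$, $\Lambda^k(\Omega)_{a,b}$ denotes the set of $k$-forms $\omega$ with $a<|\omega|^2<b$ at every point of $\Omega$. It is enough that $\rho$ be defined on $(t_1,t_2)$. *)

theory Defs
  imports "HOL-Analysis.Analysis" "HOL-Combinatorics.Permutations"
begin

section \<open>Covectors on Euclidean space\<close>

text \<open>
  A \<open>k\<close>-covector on \<open>real ^ 'n\<close> takes a sequence of vectors and reads only its first \<open>k\<close> entries;
  the remaining entries are irrelevant, so equality of covectors is equality of functions.
\<close>

type_synonym 'n covector = "(nat \<Rightarrow> real ^ 'n) \<Rightarrow> real"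

definition alternating_form :: "nat \<Rightarrow> ('n::finite) covector \<Rightarrow> bool" where
  "alternating_form k \<alpha> \<longleftrightarrow>
     (\<forall>v w. (\<forall>i<k. v i = w i) \<longrightarrow> \<alpha> v = \<alpha> w) \<and>
     (\<forall>v. \<forall>i<k. linear (\<lambda>x. \<alpha> (v(i := x)))) \<and>
     (\<forall>v. \<forall>i<k. \<forall>j<k. i \<noteq> j \<and> v i = v j \<longrightarrow> \<alpha> v = 0)"

text \<open>
  Normalised so that the wedge product of dual basis covectors \<open>dx\<^sub>1, \<dots>, dx\<^sub>p\<close> takes the value 1
  on \<open>(e\<^sub>1, \<dots>, e\<^sub>p)\<close>.
\<close>

definition wedge :: "nat \<Rightarrow> nat \<Rightarrow> ('n::finite) covector \<Rightarrow> 'n covector \<Rightarrow> 'n covector" where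
  "wedge p q \<alpha> \<beta> = (\<lambda>v.
     (\<Sum>\<sigma> | \<sigma> permutes {..<p + q}.
        of_int (sign \<sigma>) * \<alpha> (\<lambda>i. v (\<sigma> i)) * \<beta> (\<lambda>i. v (\<sigma> (p + i)))) / (fact p * fact q))"

text \<open>
  The coordinates of \<open>real ^ 'n\<close> are ordered by the linear order of \<open>'n\<close>; this order fixes the
  standard orientation. \<open>card {i. i < j}\<close> is the (zero-based) position of the coordinate \<open>j\<close>, so the
  vectors \<open>v 0, v 1, \<dots>\<close> are the rows of the matrix below.
\<close>

definition volume_form :: "('n::{finite,linorder}) covector" where
  "volume_form v = det (\<chi> j. v (card {i. i < j}))"

definition basis_tuple :: "('n::{finite,linorder}) set \<Rightarrow> nat \<Rightarrow> real ^ 'n::_" where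
  "basis_tuple I = (\<lambda>i. axis (sorted_list_of_set I ! i) 1)"

text \<open>
  The linear operator from \<open>k\<close>-covectors to \<open>(n - k)\<close>-covectors that sends \<open>dx\<^sub>I\<close> to
  \<open>w \<mapsto> vol (e\<^sub>I, w)\<close>, which is \<open>\<plusminus>dx\<^sub>J\<close> for \<open>J\<close> the complement of \<open>I\<close>, with the sign for which
  \<open>dx\<^sub>I \<and> *dx\<^sub>I = vol\<close>. The number \<open>\<alpha> (basis_tuple I)\<close> is the coefficient of \<open>dx\<^sub>I\<close> in \<open>\<alpha>\<close>.
\<close>

definition hodge_star :: "nat \<Rightarrow> ('n::{finite,linorder}) covector \<Rightarrow> 'n covector" where
  "hodge_star k \<alpha> = (\<lambda>w.
     \<Sum>I | card I = k. \<alpha> (basis_tuple I) *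
       volume_form (\<lambda>i. if i < k then basis_tuple I i else w (i - k)))"

text \<open>
  \<open>*(\<alpha> \<and> *\<alpha>)\<close> is a 0-covector, i.e. a constant function of the sequence of vectors; it is
  identified with its value. For \<open>k > n\<close> the only alternating \<open>k\<close>-form is 0, and the value is 0
  in spite of the truncated subtraction.
\<close>

definition norm_sq :: "nat \<Rightarrow> ('n::{finite,linorder}) covector \<Rightarrow> real" where
  "norm_sq k \<alpha> =
     hodge_star CARD('n) (wedge k (CARD('n) - k) \<alpha> (hodge_star k \<alpha>)) (\<lambda>_. 0)"


section \<open>Differential forms\<close>

text \<open>Intended for open \<open>S\<close>: the partial derivatives up to order \<open>m\<close> exist and are continuous on \<open>S\<close>.\<close>

primrec Ck_on :: "nat \<Rightarrow> (real ^ ('n::finite) \<Rightarrow> real) \<Rightarrow> (real ^ 'n) set \<Rightarrow> bool" where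
  "Ck_on 0 f S \<longleftrightarrow> continuous_on S f"
| "Ck_on (Suc m) f S \<longleftrightarrow>
     (\<forall>x\<in>S. f differentiable (at x)) \<and>
     (\<forall>j. Ck_on m (\<lambda>x. frechet_derivative f (at x) (axis j 1)) S)"

text \<open>
  A domain with smooth boundary: locally at each boundary point, \<open>\<Omega>\<close> is the side \<open>f < 0\<close> of a smooth
  defining function with non-vanishing gradient.
\<close>

definition smooth_domain :: "(real ^ ('n::finite)) set \<Rightarrow> bool" where
  "smooth_domain \<Omega> \<longleftrightarrow> open \<Omega> \<and> connected \<Omega> \<and> \<Omega> \<noteq> {} \<and>
     (\<forall>p\<in>frontier \<Omega>. \<exists>U f. open U \<and> p \<in> U \<and> (\<forall>m. Ck_on m f U) \<and>
        (\<exists>j. frechet_derivative f (at p) (axis j 1) \<noteq> 0) \<and>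
        \<Omega> \<inter> U = {x \<in> U. f x < 0})"

text \<open>
  \<open>\<Lambda>\<^sup>k(\<Omega>)\<close>, the \<open>k\<close>-forms of class \<open>C\<^sup>m\<close> on \<open>\<Omega>\<close>. A form is a function on \<open>\<Omega>\<close> (extensional: its value
  outside \<open>\<Omega>\<close> is \<open>undefined\<close>). Regularity means that the evaluation on any constant vector fields is
  \<open>C\<^sup>m\<close>; equivalently, the coefficients are \<open>C\<^sup>m\<close>.
\<close>

definition kforms ::
  "nat \<Rightarrow> nat \<Rightarrow> (real ^ ('n::finite)) set \<Rightarrow> (real ^ 'n::_ \<Rightarrow> 'n covector) set" where
  "kforms m k \<Omega> =
     {\<omega> \<in> \<Omega> \<rightarrow>\<^sub>E {\<alpha>. alternating_form k \<alpha>}. \<forall>v. Ck_on m (\<lambda>x. \<omega> x v) \<Omega>}"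

definition kforms_between ::
  "nat \<Rightarrow> nat \<Rightarrow> (real ^ ('n::{finite,linorder})) set \<Rightarrow> ereal \<Rightarrow> ereal \<Rightarrow>
    (real ^ 'n::_ \<Rightarrow> 'n covector) set" where
  "kforms_between m k \<Omega> a b =
     {\<omega> \<in> kforms m k \<Omega>. \<forall>x\<in>\<Omega>. a < ereal (norm_sq k (\<omega> x)) \<and> ereal (norm_sq k (\<omega> x)) < b}"


section \<open>The nonlinear map and its inverse\<close>

text \<open>The open interval \<open>(a, b)\<close> of real numbers with possibly infinite end points.\<close>

definition real_interval :: "ereal \<Rightarrow> ereal \<Rightarrow> real set" where
  "real_interval a b = {t. a < ereal t \<and> ereal t < b}"

definition phi :: "(real \<Rightarrow> real) \<Rightarrow> real \<Rightarrow> real" where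
  "phi \<rho> t = t * (\<rho> t)\<^sup>2"

definition A_map ::
  "(real \<Rightarrow> real) \<Rightarrow> nat \<Rightarrow> (real ^ ('n::{finite,linorder})) set \<Rightarrow>
    (real ^ 'n::_ \<Rightarrow> 'n covector) \<Rightarrow> (real ^ 'n::_ \<Rightarrow> 'n covector)" where
  "A_map \<rho> k \<Omega> \<omega> = (\<lambda>x\<in>\<Omega>. \<lambda>v. \<rho> (norm_sq k (\<omega> x)) * \<omega> x v)"

definition B_map ::
  "(real \<Rightarrow> real) \<Rightarrow> (real \<Rightarrow> real) \<Rightarrow> nat \<Rightarrow> (real ^ ('n::{finite,linorder})) set \<Rightarrow>
    (real ^ 'n::_ \<Rightarrow> 'n covector) \<Rightarrow> (real ^ 'n::_ \<Rightarrow> 'n covector)" where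
  "B_map \<rho> \<psi> k \<Omega> \<omega> = (\<lambda>x\<in>\<Omega>. \<lambda>v. \<omega> x v / \<rho> (\<psi> (norm_sq k (\<omega> x))))"

end

theory Submission
  imports Defs
begin

text \<open>
  The quantity \<open>norm_sq k \<alpha>\<close> is a polynomial in finitely many values of \<open>\<alpha>\<close> and is homogeneous of
  degree 2. Hence \<open>|A \<omega>|\<^sup>2 = \<phi> (|\<omega>|\<^sup>2)\<close>, and both \<open>A\<close> and \<open>B\<close> multiply a form pointwise by a \<open>C\<^sup>1\<close> function
  of \<open>|\<omega>|\<^sup>2\<close>; for \<open>B\<close> this is the inverse function theorem for \<open>\<phi>\<close>. That \<open>B\<close> inverts \<open>A\<close> is then
  the identity \<open>\<psi> (\<phi> t) = t\<close>, and that \<open>B\<close> has the right range is \<open>s / \<rho> (\<psi> s)\<^sup>2 = \<psi> s\<close>.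
\<close>

section \<open>Functions of class $C^m$\<close>

text \<open>Derivatives at a point of an open set only see values inside that set, so the behaviour
  of \<open>f\<close> and \<open>g\<close> off \<open>S\<close> is irrelevant. This is what allows
  forms that are \<open>undefined\<close> outside \<Omega>.\<close>

lemma Ck_on_cong:
  assumes "open S" and "\<And>x. x \<in> S \<Longrightarrow> f x = g x" and "Ck_on m f S"
  shows "Ck_on m g S"
  using assms(2,3)
proof (induction m arbitrary: f g)
  case 0
  then show ?case
    using continuous_on_cong[of S S f g] by simp
next
  case (Suc m)
  have diff_f: "\<And>x. x \<in> S \<Longrightarrow> f differentiable (at x)"
    and Ck_f: "\<And>j. Ck_on m (\<lambda>x. frechet_derivative f (at x) (axis j 1)) S"
    using Suc.prems(2) by simp_all
  have D: "(g has_derivative frechet_derivative f (at x)) (at x)" if "x \<in> S" for x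
    by (rule has_derivative_transform_within_open[OF _ assms(1) that Suc.prems(1)])
      (use diff_f[OF that] in \<open>simp only: frechet_derivative_works\<close>)
  have "Ck_on m (\<lambda>x. frechet_derivative g (at x) (axis j 1)) S" for j
  proof (rule Suc.IH[OF _ Ck_f])
    show "frechet_derivative f (at x) (axis j 1) = frechet_derivative g (at x) (axis j 1)"
      if "x \<in> S" for x
      by (simp only: frechet_derivative_at[OF D[OF that]])
  qed
  moreover have "g differentiable (at x)" if "x \<in> S" for x
    using D[OF that] unfolding differentiable_def by blast
  ultimately show ?case
    by simp
qed

text \<open>By uniqueness of derivatives, any explicitly computed derivative may replace
  \<open>frechet_derivative\<close>; the closure properties below are all proved through this
  rule.\<close>

lemma Ck_on_SucI:
  assumes "open S"
    and "\<And>x. x \<in> S \<Longrightarrow> (f has_derivative f' x) (at x)"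
    and "\<And>j. Ck_on m (\<lambda>x. f' x (axis j 1)) S"
  shows "Ck_on (Suc m) f S"
proof -
  have "frechet_derivative f (at x) = f' x" if "x \<in> S" for x
    using assms(2)[OF that] frechet_derivative_at by metis
  then have "Ck_on m (\<lambda>x. frechet_derivative f (at x) (axis j 1)) S" for j
    by (intro Ck_on_cong[OF assms(1) _ assms(3)[of j]]) simp
  moreover have "f differentiable (at x)" if "x \<in> S" for x
    using assms(2)[OF that] unfolding differentiable_def by blast
  ultimately show ?thesis
    by simp
qed

lemma Ck_on_Suc_has_derivative:
  "Ck_on (Suc m) f S \<Longrightarrow> x \<in> S \<Longrightarrow> (f has_derivative frechet_derivative f (at x)) (at x)"
  by (simp add: frechet_derivative_works)

lemma Ck_on_continuous_on: "Ck_on m f S \<Longrightarrow> continuous_on S f"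
  by (cases m)
    (simp, blast intro: differentiable_imp_continuous_on differentiable_at_imp_differentiable_on
      dest: Ck_on.simps(2)[THEN iffD1])

text \<open>Needed for products: the product rule leaves one factor undifferentiated, and the
  induction hypothesis requires that factor in the lower class.\<close>

lemma Ck_on_Suc_imp: "Ck_on (Suc m) f S \<Longrightarrow> Ck_on m f S"
proof (induction m arbitrary: f)
  case 0
  then show ?case
    using Ck_on_continuous_on by (simp only: Ck_on.simps(1)) blast
next
  case (Suc m)
  have "Ck_on m (\<lambda>x. frechet_derivative f (at x) (axis j 1)) S" for j
    using Suc.prems by (intro Suc.IH) simp
  with Suc.prems show ?case
    by simp
qed

lemma Ck_on_const:
  assumes "open S"
  shows "Ck_on m (\<lambda>x. c) S"
\<comment> \<open>The constant is generalised because the derivative is again a constant, namely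
  0.\<close>
proof (induction m arbitrary: c)
  case (Suc m)
  show ?case
    by (rule Ck_on_SucI[OF assms, where f' = "\<lambda>x h. 0"]) (auto simp: Suc)
qed simp

lemma Ck_on_add:
  assumes "open S" and "Ck_on m f S" and "Ck_on m g S"
  shows "Ck_on m (\<lambda>x. f x + g x) S"
  using assms(2,3)
proof (induction m arbitrary: f g)
  case 0
  then show ?case by (simp add: continuous_on_add)
next
  case (Suc m)
  show ?case
  proof (rule Ck_on_SucI[OF assms(1)])
    fix x assume "x \<in> S"
    with Suc.prems[THEN Ck_on_Suc_has_derivative]
    show "((\<lambda>x. f x + g x) has_derivative
        (\<lambda>h. frechet_derivative f (at x) h + frechet_derivative g (at x) h)) (at x)"
      by (intro has_derivative_add) auto
  qed (use Suc in auto)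
qed

lemma Ck_on_mult:
  assumes "open S" and "Ck_on m f S" and "Ck_on m g S"
  shows "Ck_on m (\<lambda>x. f x * g x) S"
  using assms(2,3)
proof (induction m arbitrary: f g)
  case 0
  then show ?case by (simp add: continuous_on_mult)
next
  case (Suc m)
  show ?case
  proof (rule Ck_on_SucI[OF assms(1)])
    fix x assume "x \<in> S"
    with Suc.prems[THEN Ck_on_Suc_has_derivative]
    show "((\<lambda>x. f x * g x) has_derivative
        (\<lambda>h. f x * frechet_derivative g (at x) h + frechet_derivative f (at x) h * g x)) (at x)"
      by (intro has_derivative_mult) auto
  next
    fix j
    show "Ck_on m (\<lambda>x. f x * frechet_derivative g (at x) (axis j 1) +
        frechet_derivative f (at x) (axis j 1) * g x) S"
      using Suc.prems Suc.prems[THEN Ck_on_Suc_imp]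
      by (intro Ck_on_add[OF assms(1)] Suc.IH) auto
  qed
qed

lemma Ck_on_sum:
  assumes "open S" and "\<And>i. i \<in> I \<Longrightarrow> Ck_on m (f i) S"
  shows "Ck_on m (\<lambda>x. \<Sum>i\<in>I. f i x) S"
  using assms(2)
  by (induction I rule: infinite_finite_induct)
    (simp_all add: Ck_on_const Ck_on_add assms(1))

text \<open>The bound \<open>m \<le> 1\<close> comes from the outer function: the chain rule
  produces \<open>h' (f x)\<close>, and \<open>h'\<close> is merely continuous.\<close>

lemma Ck_on_compose_C1:
  fixes h h' :: "real \<Rightarrow> real"
  assumes "open S" and "m \<le> 1" and f: "Ck_on m f S" and J: "\<And>x. x \<in> S \<Longrightarrow> f x \<in> J"
    and h: "\<And>s. s \<in> J \<Longrightarrow> (h has_real_derivative h' s) (at s)"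
    and h': "continuous_on J h'"
  shows "Ck_on m (\<lambda>x. h (f x)) S"
proof -
  have contf: "continuous_on S f"
    using f by (rule Ck_on_continuous_on)
  have conth: "continuous_on J h"
    using h by (meson DERIV_isCont continuous_at_imp_continuous_on)
  have sub: "f ` S \<subseteq> J"
    using J by auto
  consider "m = 0" | "m = Suc 0"
    using assms(2) by linarith
  then show ?thesis
  proof cases
    case 1
    then show ?thesis
      using continuous_on_compose2[OF conth contf sub] by simp
  next
    case 2
    have "Ck_on (Suc 0) (\<lambda>x. h (f x)) S"
    proof (rule Ck_on_SucI[OF assms(1)])
      fix x assume x: "x \<in> S"
      have "(h has_derivative (*) (h' (f x))) (at (f x))"
        using h[OF J[OF x]] by (simp add: has_field_derivative_def)
      moreover have "(f has_derivative frechet_derivative f (at x)) (at x)"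
        using f x unfolding 2 by (rule Ck_on_Suc_has_derivative)
      ultimately show "((\<lambda>x. h (f x)) has_derivative
          (\<lambda>v. h' (f x) * frechet_derivative f (at x) v)) (at x)"
        using has_derivative_compose by blast
    next
      fix j
      show "Ck_on 0 (\<lambda>x. h' (f x) * frechet_derivative f (at x) (axis j 1)) S"
        using f continuous_on_compose2[OF h' contf sub] by (simp add: 2 continuous_on_mult)
    qed
    then show ?thesis
      by (simp only: 2)
  qed
qed

section \<open>The norm of a form\<close>

lemma hodge_star_scale: "hodge_star k (\<lambda>v. c * \<alpha> v) = (\<lambda>w. c * hodge_star k \<alpha> w)"
  by (simp add: hodge_star_def sum_distrib_left mult.assoc)

lemma wedge_scale:
  "wedge p q (\<lambda>v. a * \<alpha> v) (\<lambda>v. b * \<beta> v) = (\<lambda>v. (a * b) * wedge p q \<alpha> \<beta> v)"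
  by (simp add: wedge_def sum_distrib_left mult_ac)

text \<open>The factor enters the wedge product twice, once through \<alpha> and once through its
  Hodge star; the outer star is linear.\<close>

lemma norm_sq_scale: "norm_sq k (\<lambda>v. c * \<alpha> v) = c\<^sup>2 * norm_sq k \<alpha>"
  by (simp add: norm_sq_def hodge_star_scale wedge_scale power2_eq_square)

lemma Ck_on_hodge_star:
  assumes "open S" and "\<And>v. Ck_on m (\<lambda>x. \<omega> x v) S"
  shows "Ck_on m (\<lambda>x. hodge_star k (\<omega> x) w) S"
  unfolding hodge_star_def by (intro Ck_on_sum Ck_on_mult Ck_on_const assms)

lemma Ck_on_wedge:
  assumes "open S" and "\<And>v. Ck_on m (\<lambda>x. \<omega> x v) S" and "\<And>v. Ck_on m (\<lambda>x. \<eta> x v) S"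
  shows "Ck_on m (\<lambda>x. wedge p q (\<omega> x) (\<eta> x) v) S"
  unfolding wedge_def divide_inverse by (intro Ck_on_sum Ck_on_mult Ck_on_const assms)

text \<open>After unfolding, only finite sums and products of constants and of evaluations of
  \<open>\<omega> x\<close> at tuples independent of \<open>x\<close> remain.\<close>

lemma Ck_on_norm_sq:
  assumes "open S" and "\<And>v. Ck_on m (\<lambda>x. \<omega> x v) S"
  shows "Ck_on m (\<lambda>x. norm_sq k (\<omega> x)) S"
  unfolding norm_sq_def by (intro Ck_on_hodge_star Ck_on_wedge assms)

lemma alternating_form_scale:
  assumes "alternating_form k \<alpha>"
  shows "alternating_form k (\<lambda>v. c * \<alpha> v)"
proof -
  have "linear (\<lambda>x. c * \<alpha> (v(i := x)))" if "i < k" for v i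
    using assms that linear_compose_scale_right[of "\<lambda>x. \<alpha> (v(i := x))" c]
    by (simp add: alternating_form_def)
  moreover have "c * \<alpha> v = c * \<alpha> w" if "\<forall>i<k. v i = w i" for v w
    using assms that by (metis alternating_form_def)
  moreover have "c * \<alpha> v = 0" if "i < k" "j < k" "i \<noteq> j" "v i = v j" for v i j
    using assms that unfolding alternating_form_def by auto
  ultimately show ?thesis
    unfolding alternating_form_def by blast
qed

text \<open>Serves both maps: \<open>h\<close> is \<rho> for \<open>A_map\<close>, and the
  reciprocal of \<rho> composed with \<psi> for \<open>B_map\<close>.\<close>

lemma scale_mem_kforms:
  fixes h h' :: "real \<Rightarrow> real"
  assumes "open \<Omega>" and "m \<le> 1" and \<omega>: "\<omega> \<in> kforms_between m k \<Omega> a b"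
    and h: "\<And>s. s \<in> real_interval a b \<Longrightarrow> (h has_real_derivative h' s) (at s)"
    and h': "continuous_on (real_interval a b) h'"
  shows "(\<lambda>x\<in>\<Omega>. \<lambda>v. h (norm_sq k (\<omega> x)) * \<omega> x v) \<in> kforms m k \<Omega>" (is "?\<eta> \<in> _")
proof -
  have \<omega>': "\<And>v. Ck_on m (\<lambda>x. \<omega> x v) \<Omega>" and alt: "\<And>x. x \<in> \<Omega> \<Longrightarrow> alternating_form k (\<omega> x)"
    and J: "\<And>x. x \<in> \<Omega> \<Longrightarrow> norm_sq k (\<omega> x) \<in> real_interval a b"
    using \<omega> by (auto simp: kforms_between_def kforms_def real_interval_def)
  have Ck: "Ck_on m (\<lambda>x. h (norm_sq k (\<omega> x)) * \<omega> x v) \<Omega>" for v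
    by (rule Ck_on_mult[OF assms(1) Ck_on_compose_C1[OF assms(1,2) _ J h h'] \<omega>'])
      (rule Ck_on_norm_sq[OF assms(1) \<omega>'])
  have "Ck_on m (\<lambda>x. ?\<eta> x v) \<Omega>" for v
    by (rule Ck_on_cong[OF assms(1) _ Ck[of v]]) simp
  then show ?thesis
    unfolding kforms_def using alternating_form_scale[OF alt] by simp
qed

section \<open>Intervals and the inverse function\<close>

text \<open>Openness keeps the infimum and supremum from being attained, and connectedness fills the
  gap between them. Taking both in \<open>ereal\<close> covers unbounded sets; for empty
  \<open>S\<close> they are \<infinity> and -\<infinity>, which bound the empty interval.\<close>

lemma open_connected_eq_real_interval:
  assumes "open S" and "connected S"
  shows "S = real_interval (INF s\<in>S. ereal s) (SUP s\<in>S. ereal s)"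
proof (intro equalityI subsetI)
  fix s assume "s \<in> S"
  then obtain e where e: "e > 0" "cball s e \<subseteq> S"
    using assms(1) open_contains_cball by blast
  then have "s - e \<in> S" "s + e \<in> S"
    by (auto simp: dist_real_def)
  then have "(INF s\<in>S. ereal s) \<le> ereal (s - e)" "ereal (s + e) \<le> (SUP s\<in>S. ereal s)"
    by (auto intro: INF_lower SUP_upper)
  moreover have "ereal (s - e) < ereal s" "ereal s < ereal (s + e)"
    using e by auto
  ultimately show "s \<in> real_interval (INF s\<in>S. ereal s) (SUP s\<in>S. ereal s)"
    unfolding real_interval_def by (blast intro: le_less_trans less_le_trans)
next
  fix s assume "s \<in> real_interval (INF s\<in>S. ereal s) (SUP s\<in>S. ereal s)"
  then obtain a b where "a \<in> S" "a < s" "b \<in> S" "s < b"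
    by (auto simp: real_interval_def INF_less_iff less_SUP_iff)
  then show "s \<in> S"
    using assms(2) connectedD_interval less_imp_le by metis
qed

lemma open_real_interval: "open (real_interval a b)"
  unfolding real_interval_def
  by (intro open_Collect_conj open_Collect_less continuous_intros)

lemma is_interval_real_interval: "is_interval (real_interval a b)"
  unfolding is_interval_1 real_interval_def
  by (auto intro: less_le_trans[of a] le_less_trans[of _ "ereal _" b])

text \<open>By the mean value theorem, two equal values would force a zero of the derivative between
  them. Asking for a nonzero derivative treats the increasing and the decreasing case
  together.\<close>

lemma inj_on_nonzero_derivative:
  fixes f f' :: "real \<Rightarrow> real"
  assumes "is_interval T" and f: "\<And>t. t \<in> T \<Longrightarrow> (f has_real_derivative f' t) (at t)"
    and nz: "\<And>t. t \<in> T \<Longrightarrow> f' t \<noteq> 0"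
  shows "inj_on f T"
proof (rule linorder_inj_onI')
  fix x y assume xy: "x \<in> T" "y \<in> T" "x < y"
  then have sub: "t \<in> T" if "x \<le> t" "t \<le> y" for t
    using assms(1) that unfolding is_interval_1 by blast
  obtain z where "x < z" "z < y" "f y - f x = (y - x) * f' z"
    using MVT2[OF xy(3), of f f'] f sub by auto
  then show "f x \<noteq> f y"
    using nz[of z] sub[of z] by auto
qed

text \<open>Invariance of domain supplies an open image and a continuous inverse, which are the
  topological inputs of the inverse function rule.\<close>

lemma inv_into_has_derivative:
  fixes f f' :: "real \<Rightarrow> real"
  assumes "open T" and inj: "inj_on f T"
    and f: "\<And>t. t \<in> T \<Longrightarrow> (f has_real_derivative f' t) (at t)"
    and nz: "\<And>t. t \<in> T \<Longrightarrow> f' t \<noteq> 0"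
    and s: "s \<in> f ` T"
  shows "(inv_into T f has_real_derivative inverse (f' (inv_into T f s))) (at s)"
proof -
  have contf: "continuous_on T f"
    using f by (meson DERIV_isCont continuous_at_imp_continuous_on)
  have opn: "open (f ` T)"
    using invariance_of_domain[OF contf assms(1) inj] .
  obtain g where g: "homeomorphism T (f ` T) f g"
    using invariance_of_domain_homeomorphism[OF assms(1) contf _ inj] by auto
  \<comment> \<open>The inverse \<open>g\<close> of the homeomorphism is continuous, and by
    injectivity it agrees with \<open>inv_into T f\<close> on the image.\<close>
  have "continuous_on (f ` T) (inv_into T f)"
    using homeomorphism_cont2[OF g]
    by (rule continuous_on_eq) (use g inj in \<open>auto simp: homeomorphism_def\<close>)
  then have cont: "isCont (inv_into T f) s"
    using opn s continuous_on_eq_continuous_at by blast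
  \<comment> \<open>The rule for inverse functions needs \<open>f (inv_into T f y) = y\<close> on a
    whole interval around \<open>s\<close>.\<close>
  obtain e where e: "e > 0" "ball s e \<subseteq> f ` T"
    using opn s open_contains_ball by blast
  show ?thesis
  proof (rule DERIV_inverse_function[OF _ _ _ _ _ cont, where a = "s - e" and b = "s + e"])
    show "DERIV f (inv_into T f s) :> f' (inv_into T f s)"
      using s by (intro f inv_into_into)
    show "f' (inv_into T f s) \<noteq> 0"
      using s by (intro nz inv_into_into)
    show "f (inv_into T f y) = y" if "s - e < y" "y < s + e" for y
      using e that by (intro f_inv_into_f subsetD[OF e(2)]) (auto simp: dist_real_def)
  qed (use e in auto)
qed

lemma continuous_on_inv_into:
  fixes f f' :: "real \<Rightarrow> real"
  assumes "open T" and "inj_on f T"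
    and "\<And>t. t \<in> T \<Longrightarrow> (f has_real_derivative f' t) (at t)"
    and "\<And>t. t \<in> T \<Longrightarrow> f' t \<noteq> 0"
  shows "continuous_on (f ` T) (inv_into T f)"
  using inv_into_has_derivative[OF assms]
  by (meson DERIV_isCont continuous_at_imp_continuous_on)

text \<open>The values 0 and 1 of \<open>m\<close> stand for continuous and \<open>C\<^sup>1\<close>
  forms, the classes preserved by multiplication with a \<open>C\<^sup>1\<close> function of the
  squared norm. The bijection clause identifies \<open>(r1, r2)\<close> as the image of
  \<open>(t1, t2)\<close>.\<close>

theorem theorem3p1:
  fixes \<Omega> :: "(real ^ ('n::{finite,linorder})) set"
    and k m :: nat
    and \<rho> :: "real \<Rightarrow> real"
    and t1 t2 :: ereal
  assumes "smooth_domain \<Omega>"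
    and "m \<le> 1"
    and "0 \<le> t1" and "t1 < t2"
    and "\<forall>t\<in>real_interval t1 t2. \<rho> t > 0"
    and "\<rho> C1_differentiable_on (real_interval t1 t2)"
    and "(\<forall>t\<in>real_interval t1 t2. deriv (phi \<rho>) t > 0) \<or>
         (\<forall>t\<in>real_interval t1 t2. deriv (phi \<rho>) t < 0)"
  shows "\<exists>r1 r2 :: ereal. 0 \<le> r1 \<and> r1 < r2 \<and>
    bij_betw (phi \<rho>) (real_interval t1 t2) (real_interval r1 r2) \<and>
    (let A = A_map \<rho> k \<Omega>;
         \<psi> = inv_into (real_interval t1 t2) (phi \<rho>);
         B = B_map \<rho> \<psi> k \<Omega>
     in A \<in> kforms_between m k \<Omega> t1 t2 \<rightarrow> kforms_between m k \<Omega> r1 r2 \<and>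
        B \<in> kforms_between m k \<Omega> r1 r2 \<rightarrow> kforms_between m k \<Omega> t1 t2 \<and>
        (\<forall>\<omega>\<in>kforms_between m k \<Omega> t1 t2. B (A \<omega>) = \<omega>) \<and>
        (\<forall>\<eta>\<in>kforms_between m k \<Omega> r1 r2. A (B \<eta>) = \<eta>))"
proof -

  \<comment> \<open>The image interval of \<phi> and the derivative of its inverse\<close>
  define T where "T = real_interval t1 t2"
  define \<psi> where "\<psi> = inv_into T (phi \<rho>)"
  have "open \<Omega>"
    using assms(1) by (simp add: smooth_domain_def)
  have "open T" and intT: "is_interval T"
    by (simp_all add: T_def open_real_interval is_interval_real_interval)
  have \<rho>_pos: "\<rho> t > 0" if "t \<in> T" for t
    using assms(5) that by (simp add: T_def)
  have T_pos: "t > 0" if "t \<in> T" for t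
    using assms(3) that le_less_trans[of 0 t1 "ereal t"] by (simp add: T_def real_interval_def)
  obtain \<rho>' where \<rho>': "\<And>t. t \<in> T \<Longrightarrow> (\<rho> has_real_derivative \<rho>' t) (at t)"
    and cont_\<rho>': "continuous_on T \<rho>'"
    using assms(6)
    by (auto simp: C1_differentiable_on_def T_def has_real_derivative_iff_has_vector_derivative)
  have cont_\<rho>: "continuous_on T \<rho>"
    using \<rho>' by (meson DERIV_isCont continuous_at_imp_continuous_on)
  define \<phi>' where "\<phi>' t = (\<rho> t)\<^sup>2 + 2 * t * \<rho> t * \<rho>' t" for t
  have \<phi>': "(phi \<rho> has_real_derivative \<phi>' t) (at t)" if "t \<in> T" for t
    unfolding phi_def \<phi>'_def
    by (rule derivative_eq_intros \<rho>'[OF that] refl)+ (simp add: power2_eq_square)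
  \<comment> \<open>Both sign alternatives enter only through this common consequence.\<close>
  have nz: "\<phi>' t \<noteq> 0" if "t \<in> T" for t
    using assms(7) that DERIV_imp_deriv[OF \<phi>'[OF that]] by (auto simp: T_def)
  have cont_\<phi>': "continuous_on T \<phi>'"
    unfolding \<phi>'_def by (intro continuous_intros cont_\<rho> cont_\<rho>')
  have inj: "inj_on (phi \<rho>) T"
    using inj_on_nonzero_derivative[OF intT \<phi>' nz] by blast
  have cont_\<phi>: "continuous_on T (phi \<rho>)"
    using \<phi>' by (meson DERIV_isCont continuous_at_imp_continuous_on)
  define r1 r2 where "r1 = (INF s\<in>phi \<rho> ` T. ereal s)" and "r2 = (SUP s\<in>phi \<rho> ` T. ereal s)"
  have img: "phi \<rho> ` T = real_interval r1 r2"
    unfolding r1_def r2_def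
  proof (rule open_connected_eq_real_interval)
    show "open (phi \<rho> ` T)"
      using invariance_of_domain[OF cont_\<phi> \<open>open T\<close> inj] .
    show "connected (phi \<rho> ` T)"
      using connected_continuous_image[OF cont_\<phi>] intT is_interval_connected by blast
  qed
  \<comment> \<open>A point of \<open>T\<close> exists because the reals are dense between distinct
    extended reals; its image separates \<open>r1\<close> from \<open>r2\<close>.\<close>
  obtain t where "t \<in> T"
    using ereal_dense2[OF assms(4)] by (auto simp: T_def real_interval_def)
  then have "phi \<rho> t \<in> real_interval r1 r2"
    using img by blast
  then have "r1 < r2"
    using less_trans by (auto simp: real_interval_def)
  have "0 \<le> r1"
    unfolding r1_def using T_pos by (auto simp: phi_def intro!: INF_greatest simp: less_imp_le)
  have \<psi>_mem: "\<psi> s \<in> T" and \<phi>\<psi>: "\<psi> s * (\<rho> (\<psi> s))\<^sup>2 = s" if "s \<in> real_interval r1 r2" for s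
    using that inv_into_into[of s "phi \<rho>" T] f_inv_into_f[of s "phi \<rho>" T]
    unfolding img \<psi>_def by (simp_all add: phi_def[of \<rho> "inv_into _ _ _"])
  have \<psi>\<phi>: "\<psi> (phi \<rho> t) = t" if "t \<in> T" for t
    using inj that by (simp add: \<psi>_def)
  have \<psi>': "(\<psi> has_real_derivative inverse (\<phi>' (\<psi> s))) (at s)" if "s \<in> real_interval r1 r2" for s
    using inv_into_has_derivative[OF \<open>open T\<close> inj \<phi>' nz] that by (simp add: img \<psi>_def)
  have cont_\<psi>: "continuous_on (real_interval r1 r2) \<psi>"
    using continuous_on_inv_into[OF \<open>open T\<close> inj \<phi>' nz] by (simp add: img \<psi>_def)

  \<comment> \<open>Squared norms of the images under \<open>A_map\<close> and
    \<open>B_map\<close>\<close>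
  have norm_A: "norm_sq k (A_map \<rho> k \<Omega> \<omega> x) = phi \<rho> (norm_sq k (\<omega> x))" if "x \<in> \<Omega>" for \<omega> x
    using that by (simp add: A_map_def norm_sq_scale phi_def)
  \<comment> \<open>Division becomes multiplication by a scalar function, the shape to which
    \<open>norm_sq_scale\<close> and \<open>scale_mem_kforms\<close> apply.\<close>
  have B_eq: "B_map \<rho> \<psi> k \<Omega> \<eta> = (\<lambda>x\<in>\<Omega>. \<lambda>v. inverse (\<rho> (\<psi> (norm_sq k (\<eta> x)))) * \<eta> x v)" for \<eta>
    by (simp add: B_map_def divide_inverse mult.commute)
  have norm_B: "norm_sq k (B_map \<rho> \<psi> k \<Omega> \<eta> x) = \<psi> (norm_sq k (\<eta> x))"
    if "x \<in> \<Omega>" "norm_sq k (\<eta> x) \<in> real_interval r1 r2" for \<eta> x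
  proof -
    have "norm_sq k (B_map \<rho> \<psi> k \<Omega> \<eta> x) =
        (inverse (\<rho> (\<psi> (norm_sq k (\<eta> x)))))\<^sup>2 * norm_sq k (\<eta> x)"
      using that(1) by (simp only: B_eq restrict_apply' norm_sq_scale)
    \<comment> \<open>The last factor is expanded by \<open>\<phi>\<psi>\<close> so that the squares
      of \<rho> cancel.\<close>
    also have "\<dots> = (inverse (\<rho> (\<psi> (norm_sq k (\<eta> x)))))\<^sup>2 *
        (\<psi> (norm_sq k (\<eta> x)) * (\<rho> (\<psi> (norm_sq k (\<eta> x))))\<^sup>2)"
      by (simp only: \<phi>\<psi>[OF that(2)])
    also have "\<dots> = \<psi> (norm_sq k (\<eta> x))"
      using \<rho>_pos[OF \<psi>_mem[OF that(2)]] by (simp add: power_inverse)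
    finally show ?thesis .
  qed

  have mem_t: "norm_sq k (\<omega> x) \<in> T" if "\<omega> \<in> kforms_between m k \<Omega> t1 t2" "x \<in> \<Omega>" for \<omega> x
    using that by (simp add: kforms_between_def T_def real_interval_def)
  have mem_r: "norm_sq k (\<eta> x) \<in> real_interval r1 r2"
    if "\<eta> \<in> kforms_between m k \<Omega> r1 r2" "x \<in> \<Omega>" for \<eta> x
    using that by (simp add: kforms_between_def real_interval_def)

  \<comment> \<open>Regularity and ranges of the two maps\<close>
  have A_maps: "A_map \<rho> k \<Omega> \<omega> \<in> kforms_between m k \<Omega> r1 r2"
    if \<omega>: "\<omega> \<in> kforms_between m k \<Omega> t1 t2" for \<omega>
  proof -
    have "A_map \<rho> k \<Omega> \<omega> \<in> kforms m k \<Omega>"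
      unfolding A_map_def
      by (rule scale_mem_kforms[OF \<open>open \<Omega>\<close> assms(2) \<omega> \<rho>'[unfolded T_def]
            cont_\<rho>'[unfolded T_def]])
    moreover have "norm_sq k (A_map \<rho> k \<Omega> \<omega> x) \<in> real_interval r1 r2" if "x \<in> \<Omega>" for x
      using mem_t[OF \<omega> that] img by (auto simp: norm_A[OF that])
    ultimately show ?thesis
      by (simp add: kforms_between_def real_interval_def)
  qed
  have B_maps: "B_map \<rho> \<psi> k \<Omega> \<eta> \<in> kforms_between m k \<Omega> t1 t2"
    if \<eta>: "\<eta> \<in> kforms_between m k \<Omega> r1 r2" for \<eta>
  proof -
    \<comment> \<open>The derivative of the reciprocal of \<open>\<rho> (\<psi> s)\<close>, with
      \<open>inverse (\<phi>' (\<psi> s))\<close> as the derivative of \<psi>.\<close>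
    define h' where "h' s = - (\<rho>' (\<psi> s) * inverse (\<phi>' (\<psi> s)) * inverse ((\<rho> (\<psi> s))\<^sup>2))" for s
    have "((\<lambda>s. inverse (\<rho> (\<psi> s))) has_real_derivative h' s) (at s)"
      if s: "s \<in> real_interval r1 r2" for s
    proof -
      have "\<rho> (\<psi> s) \<noteq> 0"
        using \<rho>_pos[OF \<psi>_mem[OF s]] by simp
      moreover have "((\<lambda>s. \<rho> (\<psi> s)) has_real_derivative \<rho>' (\<psi> s) * inverse (\<phi>' (\<psi> s))) (at s)"
        using DERIV_chain2[OF \<rho>'[OF \<psi>_mem[OF s]] \<psi>'[OF s]] .
      ultimately show ?thesis
        unfolding h'_def using DERIV_inverse_fun by (simp add: power2_eq_square)
    qed
    moreover have "continuous_on (real_interval r1 r2) h'"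
    proof -
      have "continuous_on (real_interval r1 r2) (\<lambda>s. f (\<psi> s))" if "continuous_on T f"
        for f :: "real \<Rightarrow> real"
        using continuous_on_compose2[OF that cont_\<psi>] \<psi>_mem by blast
      note this[OF cont_\<rho>] this[OF cont_\<rho>'] this[OF cont_\<phi>']
      moreover have "\<rho> (\<psi> s) \<noteq> 0" "\<phi>' (\<psi> s) \<noteq> 0" if "s \<in> real_interval r1 r2" for s
        using \<rho>_pos nz \<psi>_mem[OF that] by force+
      ultimately show ?thesis
        unfolding h'_def by (intro continuous_intros) auto
    qed
    ultimately have "B_map \<rho> \<psi> k \<Omega> \<eta> \<in> kforms m k \<Omega>"
      unfolding B_eq using scale_mem_kforms[OF \<open>open \<Omega>\<close> assms(2) \<eta>] by blast
    moreover have "norm_sq k (B_map \<rho> \<psi> k \<Omega> \<eta> x) \<in> T" if "x \<in> \<Omega>" for x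
      using \<psi>_mem mem_r[OF \<eta> that] norm_B[OF that] by auto
    ultimately show ?thesis
      by (simp add: kforms_between_def real_interval_def T_def)
  qed

  \<comment> \<open>The two compositions are identities\<close>
  have B_A: "B_map \<rho> \<psi> k \<Omega> (A_map \<rho> k \<Omega> \<omega>) = \<omega>"
    if \<omega>: "\<omega> \<in> kforms_between m k \<Omega> t1 t2" for \<omega>
  proof (rule extensionalityI[of _ \<Omega>])
    show "\<omega> \<in> extensional \<Omega>"
      using \<omega> by (auto simp: kforms_between_def kforms_def PiE_def)
    \<comment> \<open>The inner \<open>A_map\<close> stays folded until \<open>norm_A\<close> has
      rewritten its norm and \<open>\<psi>\<phi>\<close> has cancelled \<phi>; then the two factors
      \<rho> cancel.\<close>
    show "B_map \<rho> \<psi> k \<Omega> (A_map \<rho> k \<Omega> \<omega>) x = \<omega> x" if "x \<in> \<Omega>" for x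
      using that \<rho>_pos[OF mem_t[OF \<omega> that]]
      by (simp add: B_map_def norm_A \<psi>\<phi> mem_t[OF \<omega> that]) (simp add: A_map_def)
  qed (simp add: B_map_def)
  have A_B: "A_map \<rho> k \<Omega> (B_map \<rho> \<psi> k \<Omega> \<eta>) = \<eta>"
    if \<eta>: "\<eta> \<in> kforms_between m k \<Omega> r1 r2" for \<eta>
  proof (rule extensionalityI[of _ \<Omega>])
    show "\<eta> \<in> extensional \<Omega>"
      using \<eta> by (auto simp: kforms_between_def kforms_def PiE_def)
    \<comment> \<open>Likewise \<open>norm_B\<close> turns the argument of \<rho> into \<psi> of the
      norm of \<eta> before the inner \<open>B_map\<close> is unfolded.\<close>
    show "A_map \<rho> k \<Omega> (B_map \<rho> \<psi> k \<Omega> \<eta>) x = \<eta> x" if "x \<in> \<Omega>" for x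
      using that \<rho>_pos[OF \<psi>_mem[OF mem_r[OF \<eta> that]]]
      by (simp add: A_map_def norm_B mem_r[OF \<eta> that]) (simp add: B_map_def)
  qed (simp add: A_map_def)

  have "bij_betw (phi \<rho>) T (real_interval r1 r2)"
    using inj img by (simp add: bij_betw_def)
  then show ?thesis
    using \<open>0 \<le> r1\<close> \<open>r1 < r2\<close> A_maps B_maps B_A A_B
    unfolding Let_def \<psi>_def T_def by blast
qed

end
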